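(* Let $k\ge 2$ be an integer and let $$p_k(X)=X^k-2\left(X^{k-2}+X^{k-3}+\cdots+X+1\right).$$ For $n\ge k$ let $\tau_{n,k}=\sum_{j=1}^{n-k+1}X_jX_{j+1}\cdots X_{j+k-1}$ be the trapezoid Boolean function in the $n$ variables $X_1,\dots,X_n$. Then the sequence $\{S(\tau_{n,k})\}_{n=k}^{\infty}$ satisfies the homogeneous linear recurrence with integer coefficients whose characteristic polynomial is $p_k(X)$, i.e. $S(\tau_{n,k})=2\sum_{l=2}^{k}S(\tau_{n-l,k})$ whenever all indices are at least $k$.
   Context: A Boolean function in $n$ variables is a map $\mathbb{F}_2^n\to\mathbb{F}_2$, identified with its polynomial (algebraic normal form) in $X_1,\dots,X_n$. Its exponential sum is $S(F)=\sum_{\mathbf{x}\in\mathbb{F}_2^n}(-1)^{F(\mathbf{x})}$. A sequence $(a_n)$ satisfies the homogeneous linear recurrence with characteristic polynomial $X^d-\sum_{i=1}^d c_iX^{d-i}$ if $a_n=\sum_{i=1}^d c_ia_{n-i}$ for all admissible $n$. *)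

theory Defs
  imports
    Complex_Main
    "HOL-Library.Z2"
    "HOL-Library.FuncSet"
    "HOL-Computational_Algebra.Polynomial"
begin

text \<open>
  A point of $F_2^n$ is an extensional function on the index set \<open>{1..n}\<close> with values in the
  two-element field \<^typ>\<open>bit\<close>; a Boolean function in \<open>n\<close> variables is a function
  \<open>(nat \<Rightarrow> bit) \<Rightarrow> bit\<close>, of which only the values on \<open>F2_space n\<close> matter.
\<close>

definition F2_space :: "nat \<Rightarrow> (nat \<Rightarrow> bit) set" where
  "F2_space n = {1..n} \<rightarrow>\<^sub>E (UNIV :: bit set)"

text \<open>
  The exponent \<open>of_bit (F x)\<close> is the representative 0 or 1 of \<open>F x\<close>.
\<close>

definition exp_sum :: "nat \<Rightarrow> ((nat \<Rightarrow> bit) \<Rightarrow> bit) \<Rightarrow> int" where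
  "exp_sum n F = (\<Sum>x\<in>F2_space n. (-1) ^ (of_bit (F x) :: nat))"

text \<open>
  The upper bound is written \<open>n + 1 - k\<close> rather than \<open>n - k + 1\<close> because subtraction on
  \<^typ>\<open>nat\<close> truncates: for \<open>n < k\<close> the sum is empty instead of involving variables
  of index larger than \<open>n\<close>.
\<close>

definition trapezoid :: "nat \<Rightarrow> nat \<Rightarrow> (nat \<Rightarrow> bit) \<Rightarrow> bit" where
  "trapezoid n k x = (\<Sum>j = 1..n + 1 - k. \<Prod>i = j..j + k - 1. x i)"

text \<open>
  The sequence \<open>a\<close> is indexed from \<open>n\<^sub>0\<close>; its values below \<open>n\<^sub>0\<close> are ignored. The order \<open>d\<close> and
  the coefficients \<open>c 1, \<dots>, c d\<close> are uniquely determined by the characteristic polynomial \<open>p\<close>.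
\<close>

definition satisfies_linrec :: "(nat \<Rightarrow> 'a::comm_ring_1) \<Rightarrow> nat \<Rightarrow> 'a poly \<Rightarrow> bool" where
  "satisfies_linrec a n\<^sub>0 p \<longleftrightarrow>
     (\<exists>d c. p = monom 1 d - (\<Sum>i = 1..d. monom (c i) (d - i)) \<and>
            (\<forall>n \<ge> n\<^sub>0 + d. a n = (\<Sum>i = 1..d. c i * a (n - i))))"

definition trapezoid_poly :: "nat \<Rightarrow> int poly" where
  "trapezoid_poly k = monom 1 k - 2 * (\<Sum>j = 0..k - 2. monom 1 j)"

end

theory Submission
  imports Defs
begin

text \<open>
  Let \<open>R\<^sub>j(m)\<close> be the sum of the signs of \<open>\<tau>\<^bsub>m+j,k\<^esub>\<close> over the points of length \<open>m + j\<close> whose last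
  \<open>j\<close> coordinates are 1, so that \<open>R\<^sub>0 = S\<close>. Splitting on coordinate \<open>m + 1\<close> gives
  \<open>R\<^sub>j(m+1) = S(m) + R\<^bsub>j+1\<^esub>(m)\<close> for \<open>j < k\<close>, because a zero there kills every later window.
  Appending a 1 to \<open>k - 1\<close> trailing ones adds exactly one nonzero monomial, so
  \<open>R\<^sub>k(m) = - R\<^bsub>k-1\<^esub>(m)\<close>. Eliminating the \<open>R\<^sub>j\<close> with \<open>j > 0\<close> yields the recurrence.
\<close>

lemma trapezoid_cong:
  assumes "k \<ge> 1" "\<And>i. i \<in> {1..n} \<Longrightarrow> x i = y i"
  shows "trapezoid n k x = trapezoid n k y"
  unfolding trapezoid_def using assms by (intro sum.cong prod.cong refl) auto

lemma trapezoid_Suc: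
  assumes "k \<ge> 1" "k \<le> Suc n"
  shows "trapezoid (Suc n) k x = trapezoid n k x + (\<Prod>i = n + 2 - k..Suc n. x i)"
proof -
  have "Suc n + 1 - k = Suc (n + 1 - k)" "Suc (n + 1 - k) + k - 1 = Suc n"
    using assms by auto
  then show ?thesis
    unfolding trapezoid_def by (simp add: Suc_diff_le assms)
qed

lemma trapezoid_eq_0: "n < k \<Longrightarrow> trapezoid n k x = 0"
  by (simp add: trapezoid_def)

text \<open>A window ending at \<open>Suc m + i\<close> with \<open>i < k\<close> starts at or
  before \<open>Suc m\<close>, so its product contains the zero coordinate.\<close>

lemma trapezoid_zero_coord:
  assumes "x (Suc m) = 0" "j < k"
  shows "trapezoid (Suc m + j) k x = trapezoid m k x"
proof -
  have step: "trapezoid (Suc (m + i)) k x = trapezoid (m + i) k x" if "i < k" for i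
  \<comment> \<open>In the other case no window fits into either length and both sides are
    0.\<close>
  proof (cases "k \<le> Suc (m + i)")
    case True
    have "(\<Prod>l = m + i + 2 - k..Suc (m + i). x l) = 0"
      using assms(1) that by (intro prod_zero bexI[of _ "Suc m"]) auto
    then show ?thesis
      using True that by (simp add: trapezoid_Suc)
  qed (simp add: trapezoid_eq_0)
  show ?thesis
    using assms(2)
  proof (induction j)
    case (Suc j)
    then show ?case using step[of "Suc j"] by simp
  qed (use step[of 0] in simp)
qed

lemma sum_F2_space_Suc:
  "(\<Sum>x\<in>F2_space (Suc m). g x) =
    (\<Sum>x\<in>F2_space m. g (x(Suc m := 0))) + (\<Sum>x\<in>F2_space m. g (x(Suc m := 1)))"
proof -
  have UNIV_bit: "(UNIV :: bit set) = {0, 1}"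
    using bit.exhaust by auto
  have "{1..Suc m} = insert (Suc m) {1..m}" by auto
  then have F2: "F2_space (Suc m) = (\<lambda>(b, x). x(Suc m := b)) ` (UNIV \<times> F2_space m)"
    by (simp only: F2_space_def PiE_insert_eq)
  have inj: "inj_on (\<lambda>(b, x). x(Suc m := b)) (UNIV \<times> F2_space m)"
    unfolding F2_space_def by (rule inj_combinator) auto
  have "(\<Sum>x\<in>F2_space (Suc m). g x) = (\<Sum>b\<in>UNIV. \<Sum>x\<in>F2_space m. g (x(Suc m := b)))"
    unfolding F2 sum.reindex[OF inj] by (simp add: sum.cartesian_product case_prod_beta)
  then show ?thesis
    by (simp add: UNIV_bit)
qed

text \<open>All coordinates past \<open>m\<close> become 1, so one function serves every tail length
  \<open>j\<close> and \<open>tail_sum\<close>, which is \<open>R_j(m)\<close>, can range over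
  \<open>F2_space m\<close>.\<close>

definition ones_after :: "nat \<Rightarrow> (nat \<Rightarrow> bit) \<Rightarrow> nat \<Rightarrow> bit" where
  "ones_after m x = (\<lambda>i. if i \<le> m then x i else 1)"

definition tail_sum :: "nat \<Rightarrow> nat \<Rightarrow> nat \<Rightarrow> int" where
  "tail_sum k j m = exp_sum m (\<lambda>x. trapezoid (m + j) k (ones_after m x))"

lemma tail_sum_0:
  assumes "k \<ge> 1"
  shows "tail_sum k 0 m = exp_sum m (trapezoid m k)"
proof -
  have "trapezoid m k (ones_after m x) = trapezoid m k x" for x
    using assms by (intro trapezoid_cong) (auto simp: ones_after_def)
  then show ?thesis by (simp add: tail_sum_def)
qed

lemma tail_sum_Suc:
  assumes "j < k"
  shows "tail_sum k j (Suc m) = exp_sum m (trapezoid m k) + tail_sum k (Suc j) m"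
proof -
  have 0: "trapezoid (Suc m + j) k (ones_after (Suc m) (x(Suc m := 0))) = trapezoid m k x" for x
  proof -
    have "trapezoid (Suc m + j) k (ones_after (Suc m) (x(Suc m := 0))) =
        trapezoid m k (ones_after (Suc m) (x(Suc m := 0)))"
      using assms by (intro trapezoid_zero_coord) (simp_all add: ones_after_def)
    also have "\<dots> = trapezoid m k x"
      using assms by (intro trapezoid_cong) (auto simp: ones_after_def)
    finally show ?thesis .
  qed
  \<comment> \<open>A one at \<open>Suc m\<close> merges into the tail; as
    \<open>Suc m + j = m + Suc j\<close>, this half of the split is
    \<open>R_{j+1}(m)\<close>.\<close>
  have 1: "ones_after (Suc m) (x(Suc m := 1)) = ones_after m x" for x
    by (auto simp: ones_after_def fun_eq_iff le_Suc_eq)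
  show ?thesis
    unfolding tail_sum_def exp_sum_def sum_F2_space_Suc 0 1 by simp
qed

lemma tail_sum_full:
  assumes "k \<ge> 1"
  shows "tail_sum k k m = - tail_sum k (k - 1) m"
proof -
  have "trapezoid (m + k) k (ones_after m x) = trapezoid (m + (k - 1)) k (ones_after m x) + 1" for x
  proof -
    \<comment> \<open>The window ending at \<open>m + k\<close> is exactly the tail of ones.\<close>
    have "(\<Prod>i = Suc m..m + k. ones_after m x i) = 1"
      by (intro prod.neutral) (auto simp: ones_after_def)
    then show ?thesis
      using trapezoid_Suc[of k "m + (k - 1)" "ones_after m x"] assms by simp
  qed
  moreover have "(-1 :: int) ^ (of_bit (b + 1) :: nat) = - ((-1) ^ (of_bit b :: nat))" for b :: bit
    by (cases b) simp_all
  ultimately show ?thesis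
    by (simp add: tail_sum_def exp_sum_def sum_negf)
qed

text \<open>Iterates \<open>tail_sum_Suc\<close> from \<open>R_0(n)\<close>, at tail lengths below
  \<open>k\<close>; \<open>j \<le> n\<close> keeps the subtractions from truncating.\<close>

lemma exp_sum_eq_tail_sum:
  assumes "j \<le> k" "k \<ge> 1" "j \<le> n"
  shows "exp_sum n (trapezoid n k) =
    (\<Sum>l = 1..j. exp_sum (n - l) (trapezoid (n - l) k)) + tail_sum k j (n - j)"
  using assms
proof (induction j)
  case 0
  then show ?case by (simp add: tail_sum_0)
next
  case (Suc j)
  then have "tail_sum k j (n - j) =
      exp_sum (n - Suc j) (trapezoid (n - Suc j) k) + tail_sum k (Suc j) (n - Suc j)"
    using tail_sum_Suc[of j k "n - Suc j"] by (simp add: Suc_diff_Suc)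
  with Suc show ?case by simp
qed

text \<open>Unrolling \<open>S(n)\<close> by \<open>k\<close> steps and \<open>S(n-1)\<close> by
  \<open>k - 1\<close> steps ends at the same point \<open>n - k\<close>, with opposite tails by
  \<open>tail_sum_full\<close>. Adding the two identities cancels the tails and
  \<open>S(n-1)\<close>, and the sum over \<open>l = 2..k\<close> occurs twice.\<close>

lemma exp_sum_trapezoid_rec:
  assumes "k \<ge> 1" "n \<ge> k"
  shows "exp_sum n (trapezoid n k) = 2 * (\<Sum>l = 2..k. exp_sum (n - l) (trapezoid (n - l) k))"
proof -
  let ?S = "\<lambda>n. exp_sum n (trapezoid n k)"
  have "?S n = (\<Sum>l = 1..k. ?S (n - l)) + tail_sum k k (n - k)"
    using assms by (intro exp_sum_eq_tail_sum) auto
  moreover have "(\<Sum>l = 1..k. ?S (n - l)) = ?S (n - 1) + (\<Sum>l = 2..k. ?S (n - l))"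
    using assms by (simp add: sum.atLeast_Suc_atMost numeral_2_eq_2)
  moreover have "?S (n - 1) =
      (\<Sum>l = 1..k - 1. ?S (n - 1 - l)) + tail_sum k (k - 1) (n - 1 - (k - 1))"
    using assms by (intro exp_sum_eq_tail_sum) auto
  moreover have "n - 1 - (k - 1) = n - k"
    using assms by simp
  moreover have "(\<Sum>l = 1..k - 1. ?S (n - 1 - l)) = (\<Sum>l = 2..k. ?S (n - l))"
    by (rule sum.reindex_bij_witness[of _ "\<lambda>l. l - 1" Suc]) auto
  ultimately show ?thesis
    using tail_sum_full[OF assms(1), of "n - k"] by simp
qed

text \<open>Matches the shape required by \<open>satisfies_linrec\<close>: the missing power
  \<open>k - 1\<close> forces the coefficient 0 at \<open>i = 1\<close>.\<close>

lemma trapezoid_poly_eq: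
  assumes "k \<ge> 2"
  shows "trapezoid_poly k = monom 1 k - (\<Sum>i = 1..k. monom (if i = 1 then 0 else 2) (k - i))"
proof -
  have "(\<Sum>i = 1..k. monom (if i = 1 then 0 else 2 :: int) (k - i)) = (\<Sum>i = 2..k. monom 2 (k - i))"
    using assms by (simp add: sum.atLeast_Suc_atMost numeral_2_eq_2)
  also have "\<dots> = (\<Sum>j = 0..k - 2. monom 2 j)"
    using assms by (intro sum.reindex_bij_witness[of _ "\<lambda>j. k - j" "\<lambda>i. k - i"]) auto
  also have "\<dots> = 2 * (\<Sum>j = 0..k - 2. monom 1 j)"
    by (simp add: sum_distrib_left mult_2 add_monom)
  finally show ?thesis
    by (simp add: trapezoid_poly_def)
qed

theorem theorem2p1:
  fixes k :: nat
  assumes "k \<ge> 2"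
  shows "satisfies_linrec (\<lambda>n. exp_sum n (trapezoid n k)) k (trapezoid_poly k) \<and>
         (\<forall>n \<ge> 2 * k. exp_sum n (trapezoid n k) =
            2 * (\<Sum>l = 2..k. exp_sum (n - l) (trapezoid (n - l) k)))"
proof -
  let ?S = "\<lambda>n. exp_sum n (trapezoid n k)"
  let ?c = "\<lambda>i. if i = 1 then 0 else 2 :: int"
  have rec: "?S n = 2 * (\<Sum>l = 2..k. ?S (n - l))" if "n \<ge> k" for n
    using assms that by (intro exp_sum_trapezoid_rec) auto
  have "2 * (\<Sum>l = 2..k. ?S (n - l)) = (\<Sum>i = 1..k. ?c i * ?S (n - i))" for n
    using assms by (simp add: sum.atLeast_Suc_atMost numeral_2_eq_2 sum_distrib_left)
  \<comment> \<open>The bound is \<open>n\<^sub>0 + d\<close> with start and order both equal to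
    \<open>k\<close>.\<close>
  with rec have "\<forall>n \<ge> k + k. ?S n = (\<Sum>i = 1..k. ?c i * ?S (n - i))"
    by simp
  then have "satisfies_linrec ?S k (trapezoid_poly k)"
    unfolding satisfies_linrec_def using trapezoid_poly_eq[OF assms]
    by (intro exI[of _ k] exI[of _ ?c] conjI)
  with rec show ?thesis
    by simp
qed

end
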